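(* Let $\mu,\nu>0$ with $\mu+\nu=1$, let $N\ge 1$ be an integer, and let $(E_N(t))_{t\ge 0}$ be the Ehrenfest process with $N$ particles and parameters $\nu,\mu$. For $\alpha>0$ and $t\ge 0$ define $$I_\alpha^N(t)=e^{-\alpha t}\int_0^1(1-u)^{E_N(t)}\left(1+\frac{\nu}{\mu}u\right)^{N-E_N(t)}u^{\alpha-1}\,du,$$ $$J_\alpha^N(t)=e^{-\alpha t}\int_0^1(1-u)^{N-E_N(t)}\left(1+\frac{\mu}{\nu}u\right)^{E_N(t)}u^{\alpha-1}\,du,$$ and, for $0\le x\le N$, $T_x^{E_N}=\inf\{t>0: E_N(t)=x\}$. Then, for every $\alpha>0$, the processes $\left(I_\alpha^N(t\wedge T_0^{E_N})\right)_{t\ge0}$ and $\left(J_\alpha^N(t\wedge T_N^{E_N})\right)_{t\ge0}$ are martingales (with respect to the natural filtration of $(E_N(t))$).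
   Context: The Ehrenfest process $(E_N(t))_{t\ge0}$ with $N$ particles and parameters $\nu,\mu>0$ is the continuous-time (right-continuous) birth and death Markov process on $\{0,1,\ldots,N\}$ with transition rates $q(x,x+1)=\nu(N-x)$ and $q(x,x-1)=\mu x$ for $0\le x\le N$. The time scale is normalized so that $\mu+\nu=1$. Notation: $a\wedge b=\min(a,b)$. *)

theory Defs
  imports "HOL-Probability.Probability"
begin

section \<open>Continuous-time martingales\<close>

text \<open>The time set is the half-line of nonnegative reals; values of processes and filtrations at
  negative times are irrelevant throughout.\<close>

definition martingale ::
  "'a measure \<Rightarrow> (real \<Rightarrow> 'a measure) \<Rightarrow> (real \<Rightarrow> 'a \<Rightarrow> real) \<Rightarrow> bool" where
  "martingale M F Y \<longleftrightarrow>
     (\<forall>t\<ge>0. subalgebra M (F t)) \<and>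
     (\<forall>s t. 0 \<le> s \<and> s \<le> t \<longrightarrow> subalgebra (F t) (F s)) \<and>
     (\<forall>t\<ge>0. Y t \<in> borel_measurable (F t) \<and> integrable M (Y t)) \<and>
     (\<forall>s t. 0 \<le> s \<and> s \<le> t \<longrightarrow> (AE \<omega> in M. real_cond_exp M (F s) (Y t) \<omega> = Y s \<omega>))"

definition natural_filtration ::
  "'a measure \<Rightarrow> (real \<Rightarrow> 'a \<Rightarrow> nat) \<Rightarrow> real \<Rightarrow> 'a measure" where
  "natural_filtration M X t =
     sigma (space M) {X s -` A \<inter> space M | s A. 0 \<le> s \<and> s \<le> t}"

text \<open>Hitting times are extended-real valued, with \<open>Inf {} = \<infinity>\<close>.\<close>

definition hitting_time :: "(real \<Rightarrow> 'a \<Rightarrow> nat) \<Rightarrow> nat \<Rightarrow> 'a \<Rightarrow> ereal" where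
  "hitting_time X x \<omega> = Inf {ereal t | t. t > 0 \<and> X t \<omega> = x}"

definition stopped_process ::
  "(real \<Rightarrow> 'a \<Rightarrow> real) \<Rightarrow> ('a \<Rightarrow> ereal) \<Rightarrow> real \<Rightarrow> 'a \<Rightarrow> real" where
  "stopped_process Y T t \<omega> = Y (real_of_ereal (min (ereal t) (T \<omega>))) \<omega>"

section \<open>Finite-state continuous-time Markov processes\<close>

definition transition_function :: "nat set \<Rightarrow> (real \<Rightarrow> nat \<Rightarrow> nat \<Rightarrow> real) \<Rightarrow> bool" where
  "transition_function S p \<longleftrightarrow>
     (\<forall>t\<ge>0. \<forall>x\<in>S. \<forall>y\<in>S. 0 \<le> p t x y) \<and>
     (\<forall>t\<ge>0. \<forall>x\<in>S. (\<Sum>y\<in>S. p t x y) = 1) \<and>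
     (\<forall>x\<in>S. \<forall>y\<in>S. p 0 x y = (if x = y then 1 else 0)) \<and>
     (\<forall>s\<ge>0. \<forall>t\<ge>0. \<forall>x\<in>S. \<forall>y\<in>S. p (s + t) x y = (\<Sum>z\<in>S. p s x z * p t z y))"

text \<open>Only the rates \<open>q x y\<close> with \<open>x \<noteq> y\<close> are meaningful: they are the one-sided derivatives at
  time \<open>0\<close> of the transition probabilities. On a finite state space the diagonal derivatives are
  then determined, because the transition probabilities sum to one.\<close>

definition has_transition_rates ::
  "nat set \<Rightarrow> (real \<Rightarrow> nat \<Rightarrow> nat \<Rightarrow> real) \<Rightarrow> (nat \<Rightarrow> nat \<Rightarrow> real) \<Rightarrow> bool" where
  "has_transition_rates S p q \<longleftrightarrow>
     (\<forall>x\<in>S. \<forall>y\<in>S. x \<noteq> y \<longrightarrow>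
        ((\<lambda>t. p t x y) has_real_derivative q x y) (at 0 within {0..}))"

text \<open>A right-continuous time-homogeneous Markov process, with respect to its natural filtration
  and with arbitrary initial law, on the finite state space \<open>S\<close>. The topology of type \<open>nat\<close> is
  discrete, so right-continuity means that paths are locally constant to the right.\<close>

definition markov_process_with_rates ::
  "'a measure \<Rightarrow> nat set \<Rightarrow> (nat \<Rightarrow> nat \<Rightarrow> real) \<Rightarrow> (real \<Rightarrow> 'a \<Rightarrow> nat) \<Rightarrow> bool" where
  "markov_process_with_rates M S q X \<longleftrightarrow>
     prob_space M \<and> finite S \<and>
     (\<forall>t\<ge>0. X t \<in> measurable M (count_space UNIV)) \<and>
     (\<forall>t\<ge>0. \<forall>\<omega>\<in>space M. X t \<omega> \<in> S) \<and>
     (\<forall>\<omega>\<in>space M. \<forall>t\<ge>0. continuous (at_right t) (\<lambda>s. X s \<omega>)) \<and>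
     (\<exists>p. transition_function S p \<and> has_transition_rates S p q \<and>
        (\<forall>s\<ge>0. \<forall>t\<ge>0. \<forall>y\<in>S. AE \<omega> in M.
           real_cond_exp M (natural_filtration M X s)
             (indicator {\<omega>'\<in>space M. X (s + t) \<omega>' = y}) \<omega> = p t (X s \<omega>) y))"

section \<open>The Ehrenfest process\<close>

definition ehrenfest_rate :: "nat \<Rightarrow> real \<Rightarrow> real \<Rightarrow> nat \<Rightarrow> nat \<Rightarrow> real" where
  "ehrenfest_rate N \<nu> \<mu> x y =
     (if y = x + 1 then \<nu> * (real N - real x)
      else if x = y + 1 then \<mu> * real x
      else 0)"

definition ehrenfest_process ::
  "'a measure \<Rightarrow> nat \<Rightarrow> real \<Rightarrow> real \<Rightarrow> (real \<Rightarrow> 'a \<Rightarrow> nat) \<Rightarrow> bool" where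
  "ehrenfest_process M N \<nu> \<mu> E \<longleftrightarrow>
     markov_process_with_rates M {0..N} (ehrenfest_rate N \<nu> \<mu>) E"

definition I_process ::
  "nat \<Rightarrow> real \<Rightarrow> real \<Rightarrow> (real \<Rightarrow> 'a \<Rightarrow> nat) \<Rightarrow> real \<Rightarrow> real \<Rightarrow> 'a \<Rightarrow> real" where
  "I_process N \<nu> \<mu> E \<alpha> t \<omega> =
     exp (- \<alpha> * t) *
     (LBINT u:{0..1}. (1 - u) ^ E t \<omega> * (1 + \<nu> / \<mu> * u) ^ (N - E t \<omega>) * u powr (\<alpha> - 1))"

definition J_process ::
  "nat \<Rightarrow> real \<Rightarrow> real \<Rightarrow> (real \<Rightarrow> 'a \<Rightarrow> nat) \<Rightarrow> real \<Rightarrow> real \<Rightarrow> 'a \<Rightarrow> real" where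
  "J_process N \<nu> \<mu> E \<alpha> t \<omega> =
     exp (- \<alpha> * t) *
     (LBINT u:{0..1}. (1 - u) ^ (N - E t \<omega>) * (1 + \<mu> / \<nu> * u) ^ E t \<omega> * u powr (\<alpha> - 1))"

end

(*
  If f is an eigenfunction of the generator, G f = alpha f, at every state other than z, then
  exp (- alpha t) f (X t), stopped at the hitting time of z, is a martingale. To see this, sample
  the process on a grid of mesh h in [s, t] and stop it at the first grid point at which X is in z.
  By the Markov property and the rates at time 0, each step changes the expectation by o(h), so the
  total error tends to 0; by right-continuity the grid-stopped values converge to the stopped process,
  and dominated convergence applies.

  For g u x = (1 - u)^x (1 + nu/mu u)^(N - x) one has G (g u) (x) = - u d/du (g u x). Integration by
  parts against u^(alpha - 1) gives G f = alpha f for f x = int_0^1 g u x u^(alpha - 1) du, the boundary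
  term at u = 1 being zero exactly when x > 0. J is the same with the roles of the two kinds of
  particles exchanged.
*)
theory Submission
  imports Defs
begin

section \<open>The natural filtration\<close>

lemma space_natural_filtration [simp]: "space (natural_filtration M X t) = space M"
  unfolding natural_filtration_def by (rule space_measure_of) auto

lemma sets_natural_filtration:
  "sets (natural_filtration M X t) =
     sigma_sets (space M) {X s -` A \<inter> space M | s A. 0 \<le> s \<and> s \<le> t}"
  unfolding natural_filtration_def by (rule sets_measure_of) auto

lemma measurable_natural_filtration:
  assumes "0 \<le> s" "s \<le> t"
  shows "X s \<in> measurable (natural_filtration M X t) (count_space UNIV)"
proof (rule measurableI)
  fix A show "X s -` A \<inter> space (natural_filtration M X t) \<in> sets (natural_filtration M X t)"
    unfolding sets_natural_filtration using assms by (auto intro!: sigma_sets.Basic)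
qed simp

lemma subalgebra_natural_filtration_mono:
  assumes "s \<le> t"
  shows "subalgebra (natural_filtration M X t) (natural_filtration M X s)"
  unfolding subalgebra_def sets_natural_filtration space_natural_filtration
  using assms by (intro conjI refl sigma_sets_mono') (force intro: order_trans)

lemma hitting_time_nonneg: "0 \<le> hitting_time X z \<omega>"
  unfolding hitting_time_def by (intro Inf_greatest) auto

section \<open>Path regularity, hitting times and stopped processes\<close>

locale finite_markov_process = prob_space M
  for M :: "'a measure" +
  fixes S :: "nat set" and q :: "nat \<Rightarrow> nat \<Rightarrow> real" and X :: "real \<Rightarrow> 'a \<Rightarrow> nat"
  assumes markov: "markov_process_with_rates M S q X"
begin

lemma finite_states: "finite S"
  using markov unfolding markov_process_with_rates_def by blast

lemma state_mem: "0 \<le> t \<Longrightarrow> \<omega> \<in> space M \<Longrightarrow> X t \<omega> \<in> S"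
  using markov unfolding markov_process_with_rates_def by blast

lemma measurable_process: "0 \<le> t \<Longrightarrow> X t \<in> measurable M (count_space UNIV)"
  using markov unfolding markov_process_with_rates_def by blast

lemma subalgebra_natural_filtration: "subalgebra M (natural_filtration M X t)"
  unfolding subalgebra_def sets_natural_filtration space_natural_filtration
  using measurable_process
  by (intro conjI refl sets.sigma_sets_subset) (auto intro: measurable_sets)

text \<open>The topology of \<open>nat\<close> is discrete, so \<open>{X t \<omega>}\<close> is open
  and right-continuity forces the path to stay in it for a while. The filter
  \<open>at_right t\<close> only sees times after \<open>t\<close>; the time \<open>t\<close> itself
  is trivial.\<close>

lemma locally_constant_right:
  assumes "\<omega> \<in> space M" "0 \<le> t"
  obtains d where "d > 0" "\<And>s. t \<le> s \<Longrightarrow> s < t + d \<Longrightarrow> X s \<omega> = X t \<omega>"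
proof -
  have "((\<lambda>s. X s \<omega>) \<longlongrightarrow> X t \<omega>) (at_right t)"
    using markov assms unfolding markov_process_with_rates_def continuous_within by blast
  then have "eventually (\<lambda>s. X s \<omega> \<in> {X t \<omega>}) (at_right t)"
    by (rule topological_tendstoD) (simp_all add: Topological_Spaces.open_discrete)
  then obtain b where "b > t" "\<forall>s>t. s < b \<longrightarrow> X s \<omega> = X t \<omega>"
    unfolding eventually_at_right_field by auto
  then show thesis
    by (intro that[of "b - t"]) (auto simp: order_le_less)
qed

text \<open>Although the infimum is over positive times, the initial time counts and the infimum is
  attained, because paths are locally constant to the right.\<close>

lemma hitting_time_le_iff:
  assumes \<omega>: "\<omega> \<in> space M" and "0 \<le> t"
  shows "hitting_time X z \<omega> \<le> ereal t \<longleftrightarrow> (\<exists>r. 0 \<le> r \<and> r \<le> t \<and> X r \<omega> = z)"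
proof
  assume "\<exists>r. 0 \<le> r \<and> r \<le> t \<and> X r \<omega> = z"
  then obtain r where r: "0 \<le> r" "r \<le> t" "X r \<omega> = z" by blast
  obtain d where d: "d > 0" "\<And>s. r \<le> s \<Longrightarrow> s < r + d \<Longrightarrow> X s \<omega> = X r \<omega>"
    using locally_constant_right[OF \<omega> r(1)] by metis
  have "hitting_time X z \<omega> \<le> ereal (r + e)" if "e > 0" for e
  proof -
    \<comment> \<open>A visit time that is strictly positive even when \<open>r = 0\<close>, lies
      within \<open>e\<close> of \<open>r\<close>, and still belongs to the interval on which the
      path stays in \<open>z\<close>.\<close>
    let ?s = "r + min e (d/2)"
    have "hitting_time X z \<omega> \<le> ereal ?s"
      unfolding hitting_time_def using d r that by (intro Inf_lower) (auto intro!: exI[of _ ?s])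
    also have "\<dots> \<le> ereal (r + e)" by simp
    finally show ?thesis .
  qed
  then have "hitting_time X z \<omega> \<le> ereal r"
    by - (rule ereal_le_epsilon2, simp only: plus_ereal.simps)
  also have "ereal r \<le> ereal t" using r by simp
  finally show "hitting_time X z \<omega> \<le> ereal t" .
next
  assume le: "hitting_time X z \<omega> \<le> ereal t"
  define r where "r = real_of_ereal (hitting_time X z \<omega>)"
  have r: "hitting_time X z \<omega> = ereal r" "0 \<le> r" "r \<le> t"
    using le hitting_time_nonneg[of X z \<omega>] unfolding r_def
    by (cases "hitting_time X z \<omega>"; simp)+
  obtain d where d: "d > 0" "\<And>s. r \<le> s \<Longrightarrow> s < r + d \<Longrightarrow> X s \<omega> = X r \<omega>"
    using locally_constant_right[OF \<omega> r(2)] by metis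
  \<comment> \<open>The infimum yields a visit at some time in \<open>[r, r + d)\<close>; since the
    path is constant there, the visit carries back to \<open>r\<close>.\<close>
  have "hitting_time X z \<omega> < ereal (r + d)" using r d by simp
  then obtain s where s: "s < r + d" "s > 0" "X s \<omega> = z"
    unfolding hitting_time_def Inf_less_iff by auto
  have "hitting_time X z \<omega> \<le> ereal s"
    unfolding hitting_time_def using s by (intro Inf_lower) auto
  with r have "r \<le> s" by simp
  with d s have "X r \<omega> = z" by metis
  with r show "\<exists>r. 0 \<le> r \<and> r \<le> t \<and> X r \<omega> = z" by blast
qed

text \<open>There is a visit at some \<open>r' \<le> r\<close>, and a visit at \<open>r'\<close>
  bounds the hitting time by \<open>r'\<close>. Hence \<open>r' = r\<close>.\<close>

lemma hitting_time_attained: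
  assumes "\<omega> \<in> space M" "hitting_time X z \<omega> = ereal r"
  shows "0 \<le> r" "X r \<omega> = z"
proof -
  show r: "0 \<le> r" using hitting_time_nonneg[of X z \<omega>] assms by simp
  obtain r' where r': "0 \<le> r'" "r' \<le> r" "X r' \<omega> = z"
    using hitting_time_le_iff[OF assms(1) r, of z] assms by auto
  have "hitting_time X z \<omega> \<le> ereal r'"
    using hitting_time_le_iff[OF assms(1) r'(1), of z] r' by blast
  with assms r' show "X r \<omega> = z" by simp
qed

text \<open>This is the stopping time property for the natural filtration, without any augmentation.
  A visit at a time before \<open>t\<close> lasts for a right neighbourhood, which contains a
  rational below \<open>t\<close>; hence the union over visit times can be taken over the rationals
  in \<open>[0, t]\<close> together with \<open>t\<close> itself.\<close>

lemma sets_hitting_time_le: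
  assumes "0 \<le> t"
  shows "{\<omega>\<in>space M. hitting_time X z \<omega> \<le> ereal t} \<in> sets (natural_filtration M X t)"
proof -
  let ?R = "insert t (\<rat> \<inter> {0..t})"
  have "(\<exists>r. 0 \<le> r \<and> r \<le> t \<and> X r \<omega> = z) \<longleftrightarrow> (\<exists>r\<in>?R. X r \<omega> = z)" if \<omega>: "\<omega> \<in> space M" for \<omega>
  proof
    assume "\<exists>r. 0 \<le> r \<and> r \<le> t \<and> X r \<omega> = z"
    then obtain r where r: "0 \<le> r" "r \<le> t" "X r \<omega> = z" by blast
    show "\<exists>r\<in>?R. X r \<omega> = z"
    proof (cases "r = t")
      case False
      obtain d where d: "d > 0" "\<And>s. r \<le> s \<Longrightarrow> s < r + d \<Longrightarrow> X s \<omega> = X r \<omega>"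
        using locally_constant_right[OF \<omega> r(1)] by metis
      have "r < min t (r + d)" using False r(2) d(1) by simp
      then obtain x where "x \<in> \<rat>" "r < x" "x < min t (r + d)"
        using Rats_dense_in_real by blast
      with d(2)[of x] r show ?thesis by (intro bexI[of _ x]) simp_all
    qed (use r in auto)
  qed (use assms in auto)
  then have "{\<omega>\<in>space M. hitting_time X z \<omega> \<le> ereal t} =
      (\<Union>r\<in>?R. X r -` {z} \<inter> space (natural_filtration M X t))"
    using hitting_time_le_iff[OF _ assms] by auto
  also have "\<dots> \<in> sets (natural_filtration M X t)"
  proof -
    have "countable ?R"
      using countable_rat by (auto intro: countable_subset[OF Int_lower1])
    moreover have "X r -` {z} \<inter> space (natural_filtration M X t) \<in> sets (natural_filtration M X t)"
      if "r \<in> ?R" for r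
    proof (rule measurable_sets)
      show "X r \<in> measurable (natural_filtration M X t) (count_space UNIV)"
        using assms that by (intro measurable_natural_filtration) auto
    qed simp
    ultimately show ?thesis by (intro sets.countable_UN'') blast
  qed
  finally show ?thesis .
qed

lemma measurable_stopped_time:
  assumes "0 \<le> t"
  shows "(\<lambda>\<omega>. real_of_ereal (min (ereal t) (hitting_time X z \<omega>)))
           \<in> borel_measurable (natural_filtration M X t)"
proof (rule borel_measurableI_le)
  fix a
  \<comment> \<open>The sublevel set is everything for \<open>t \<le> a\<close>, empty for negative
    \<open>a\<close> below \<open>t\<close>, and otherwise an event already known at time
    \<open>a < t\<close>.\<close>
  have *: "real_of_ereal (min (ereal t) (hitting_time X z \<omega>)) \<le> a \<longleftrightarrow>
      t \<le> a \<or> 0 \<le> a \<and> hitting_time X z \<omega> \<le> ereal a" for \<omega>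
    using hitting_time_nonneg[of X z \<omega>] assms
    by (cases "hitting_time X z \<omega>") (auto simp: min_def)
  consider "t \<le> a" | "a < t" "a < 0" | "a < t" "0 \<le> a" by linarith
  then show "{\<omega> \<in> space (natural_filtration M X t).
      real_of_ereal (min (ereal t) (hitting_time X z \<omega>)) \<le> a} \<in> sets (natural_filtration M X t)"
  proof cases
    case 3
    then show ?thesis
      unfolding * using sets_hitting_time_le[of a z] subalgebra_natural_filtration_mono[of a t M X]
      by (auto simp: subalgebra_def)
  next
    case 1
    then show ?thesis unfolding * using sets.top[of "natural_filtration M X t"] by simp
  qed (simp add: *)
qed

text \<open>At the hitting time the state is \<open>z\<close>. The right-hand side therefore never
  evaluates \<open>X\<close> at a random time, and measurability of the stopped process needs no
  joint measurability of \<open>X\<close> in time and outcome.\<close>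

lemma stopped_process_eq:
  assumes "\<omega> \<in> space M" "0 \<le> t"
  shows "stopped_process (\<lambda>t \<omega>. exp (- \<alpha> * t) * f (X t \<omega>)) (hitting_time X z) t \<omega> =
    (if hitting_time X z \<omega> \<le> ereal t
     then exp (- \<alpha> * real_of_ereal (min (ereal t) (hitting_time X z \<omega>))) * f z
     else exp (- \<alpha> * t) * f (X t \<omega>))"
proof (cases "hitting_time X z \<omega> \<le> ereal t")
  case True
  then obtain r where r: "hitting_time X z \<omega> = ereal r"
    using hitting_time_nonneg[of X z \<omega>] by (cases "hitting_time X z \<omega>") auto
  with True hitting_time_attained[OF assms(1) r] show ?thesis
    by (simp add: stopped_process_def min_def)
next
  case False
  then show ?thesis by (simp add: stopped_process_def min.absorb1 less_imp_le)
qed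

lemma measurable_stopped_process:
  assumes "0 \<le> t"
  shows "stopped_process (\<lambda>t \<omega>. exp (- \<alpha> * t) * f (X t \<omega>)) (hitting_time X z) t
    \<in> borel_measurable (natural_filtration M X t)"
proof -
  have [measurable]: "Measurable.pred (natural_filtration M X t) (\<lambda>\<omega>. hitting_time X z \<omega> \<le> ereal t)"
    using sets_hitting_time_le[OF assms, of z] unfolding pred_def by simp
  note [measurable] = measurable_stopped_time[OF assms, of z]
  have [measurable]: "(\<lambda>\<omega>. f (X t \<omega>)) \<in> borel_measurable (natural_filtration M X t)"
    by (rule measurable_compose[OF measurable_natural_filtration]) (use assms in auto)
  have "(\<lambda>\<omega>. if hitting_time X z \<omega> \<le> ereal t
     then exp (- \<alpha> * real_of_ereal (min (ereal t) (hitting_time X z \<omega>))) * f z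
     else exp (- \<alpha> * t) * f (X t \<omega>)) \<in> borel_measurable (natural_filtration M X t)"
    by measurable
  then show ?thesis
    by (rule measurable_cong[THEN iffD1, rotated]) (simp only: space_natural_filtration stopped_process_eq[OF _ assms])
qed

end

section \<open>One-step expectations from the Markov property and the rates\<close>

context finite_markov_process
begin

lemma abs_state_le: "0 \<le> s \<Longrightarrow> \<omega> \<in> space M \<Longrightarrow> \<bar>g (X s \<omega>)\<bar> \<le> (\<Sum>y\<in>S. \<bar>g y :: real\<bar>)"
  using state_mem finite_states by (intro member_le_sum[of _ _ "\<lambda>y. \<bar>g y\<bar>"]) auto

lemma measurable_state: "0 \<le> s \<Longrightarrow> (\<lambda>\<omega>. g (X s \<omega>) :: real) \<in> borel_measurable M"
  by (rule measurable_compose[OF measurable_process]) auto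

lemma integrable_state: "0 \<le> s \<Longrightarrow> integrable M (\<lambda>\<omega>. g (X s \<omega>) :: real)"
  using measurable_state abs_state_le
  by (intro integrable_const_bound[of _ "\<Sum>y\<in>S. \<bar>g y\<bar>"]) auto

lemma sets_natural_filtration_imp: "A \<in> sets (natural_filtration M X t) \<Longrightarrow> A \<in> sets M"
  using subalgebra_natural_filtration unfolding subalgebra_def by blast

lemma integrable_indicator_state:
  "0 \<le> s \<Longrightarrow> D \<in> sets M \<Longrightarrow> integrable M (\<lambda>\<omega>. indicator D \<omega> * g (X s \<omega>) :: real)"
  using integrable_mult_indicator[OF _ integrable_state] by simp

lemma sigma_finite_subalgebra_natural_filtration:
  "sigma_finite_subalgebra M (natural_filtration M X s)"
  using subalgebra_natural_filtration
  by (intro finite_measure_subalgebra_is_sigma_finite finite_measure_subalgebra.intro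
      finite_measure_subalgebra_axioms.intro finite_measure_axioms)

text \<open>The Markov property tested against a past event \<open>D\<close>. As \<open>S\<close> is
  finite, \<open>f (X (s + h))\<close> is a finite combination of indicators of
  \<open>X (s + h) = y\<close>, and the conditional probability of each of them is given by
  \<open>cond\<close>.\<close>

lemma integral_transition:
  assumes cond: "\<And>y. y \<in> S \<Longrightarrow> AE \<omega> in M. real_cond_exp M (natural_filtration M X s)
             (indicator {\<omega>'\<in>space M. X (s + h) \<omega>' = y}) \<omega> = p (X s \<omega>) y"
    and "0 \<le> s" "0 \<le> h" and D: "D \<in> sets (natural_filtration M X s)"
  shows "(\<integral>\<omega>. indicator D \<omega> * f (X (s + h) \<omega>) \<partial>M) =
         (\<integral>\<omega>. indicator D \<omega> * (\<Sum>y\<in>S. p (X s \<omega>) y * f y) \<partial>M)"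
proof -
  interpret F: sigma_finite_subalgebra M "natural_filtration M X s"
    by (rule sigma_finite_subalgebra_natural_filtration)
  have sh: "0 \<le> s + h" using assms by simp
  have DM: "D \<in> sets M" using D by (rule sets_natural_filtration_imp)
  define H where "H y = {\<omega>'\<in>space M. X (s + h) \<omega>' = y}" for y
  have H_sets: "H y \<in> sets M" for y
  proof -
    have "H y = X (s + h) -` {y} \<inter> space M" unfolding H_def by auto
    then show ?thesis using measurable_sets[OF measurable_process[OF sh], of "{y}"] by simp
  qed
  have int: "integrable M (indicat_real (H y))" for y
    using H_sets by (simp add: emeasure_eq_measure)
  have int': "integrable M (\<lambda>\<omega>. indicator D \<omega> * indicat_real (H y) \<omega>)" for y
    using integrable_mult_indicator[OF DM int] by simp
  have step: "(\<integral>\<omega>. indicator D \<omega> * indicat_real (H y) \<omega> \<partial>M) =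
      (\<integral>\<omega>. indicator D \<omega> * p (X s \<omega>) y \<partial>M)" if "y \<in> S" for y
  proof -
    have "(\<integral>\<omega>. indicator D \<omega> * indicat_real (H y) \<omega> \<partial>M) =
       (\<integral>\<omega>. indicator D \<omega> * real_cond_exp M (natural_filtration M X s) (indicator (H y)) \<omega> \<partial>M)"
      using F.real_cond_exp_intA[OF int D] unfolding set_lebesgue_integral_def by simp
    also have "\<dots> = (\<integral>\<omega>. indicator D \<omega> * p (X s \<omega>) y \<partial>M)"
    proof (rule integral_cong_AE)
      show "AE \<omega> in M. indicator D \<omega> * real_cond_exp M (natural_filtration M X s) (indicator (H y)) \<omega>
              = indicator D \<omega> * p (X s \<omega>) y"
        using cond[OF that] unfolding H_def by eventually_elim simp
      show "(\<lambda>\<omega>. indicator D \<omega> * p (X s \<omega>) y) \<in> borel_measurable M"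
        using integrable_indicator_state[OF \<open>0 \<le> s\<close> DM, of "\<lambda>x. p x y"]
        by (rule borel_measurable_integrable)
    qed (use DM in simp)
    finally show ?thesis .
  qed
  have "(\<integral>\<omega>. indicator D \<omega> * f (X (s + h) \<omega>) \<partial>M) =
      (\<integral>\<omega>. (\<Sum>y\<in>S. f y * (indicator D \<omega> * indicat_real (H y) \<omega>)) \<partial>M)"
  proof (rule Bochner_Integration.integral_cong)
    fix \<omega> assume \<omega>: "\<omega> \<in> space M"
    have "(\<Sum>y\<in>S. f y * (indicator D \<omega> * indicat_real (H y) \<omega>)) =
        (\<Sum>y\<in>S. if y = X (s + h) \<omega> then indicator D \<omega> * f y else 0)"
      using \<omega> by (intro sum.cong) (auto simp: H_def indicator_def)
    also have "\<dots> = indicator D \<omega> * f (X (s + h) \<omega>)"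
      using state_mem[OF sh \<omega>] finite_states by (simp add: sum.delta)
    finally show "indicator D \<omega> * f (X (s + h) \<omega>) =
        (\<Sum>y\<in>S. f y * (indicator D \<omega> * indicat_real (H y) \<omega>))" by simp
  qed simp
  also have "\<dots> = (\<Sum>y\<in>S. f y * (\<integral>\<omega>. indicator D \<omega> * indicat_real (H y) \<omega> \<partial>M))"
    using int' by (subst Bochner_Integration.integral_sum) auto
  also have "\<dots> = (\<Sum>y\<in>S. f y * (\<integral>\<omega>. indicator D \<omega> * p (X s \<omega>) y \<partial>M))"
    using step by simp
  also have "\<dots> = (\<integral>\<omega>. (\<Sum>y\<in>S. f y * (indicator D \<omega> * p (X s \<omega>) y)) \<partial>M)"
    using integrable_indicator_state[OF \<open>0 \<le> s\<close> DM, of "\<lambda>x. p x _"]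
    by (subst Bochner_Integration.integral_sum) auto
  also have "\<dots> = (\<integral>\<omega>. indicator D \<omega> * (\<Sum>y\<in>S. p (X s \<omega>) y * f y) \<partial>M)"
    by (intro Bochner_Integration.integral_cong) (auto simp: sum_distrib_left mult_ac)
  finally show ?thesis .
qed

end

text \<open>As a function of \<open>h\<close>, the difference vanishes at 0, and its right
  derivative there is the generator applied to \<open>f\<close> minus \<alpha> times
  \<open>f\<close>, at \<open>x\<close>. This is zero by \<open>eigen\<close>, so the difference is
  o(h).\<close>

lemma eigenfunction_semigroup_error:
  fixes f :: "nat \<Rightarrow> real"
  assumes "finite S" and tf: "transition_function S p" and rates: "has_transition_rates S p q"
    and x: "x \<in> S" and eigen: "(\<Sum>y\<in>S - {x}. q x y * (f y - f x)) = \<alpha> * f x"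
    and "\<epsilon> > 0"
  shows "eventually (\<lambda>h. \<bar>exp (- \<alpha> * h) * (\<Sum>y\<in>S. p h x y * f y) - f x\<bar> \<le> \<epsilon> * h) (at 0 within {0..})"
proof -
  \<comment> \<open>Since the transition probabilities sum to one, the diagonal term can be
    eliminated; only off-diagonal derivatives, which are the given rates, remain to be
    taken.\<close>
  define r where "r h = exp (- \<alpha> * h) * (f x + (\<Sum>y\<in>S - {x}. p h x y * (f y - f x))) - f x" for h
  have p0: "p 0 x y = 0" if "y \<in> S - {x}" for y
    using tf x that unfolding transition_function_def by auto
  have r_eq: "exp (- \<alpha> * h) * (\<Sum>y\<in>S. p h x y * f y) - f x = r h" if "0 \<le> h" for h
  proof -
    have one: "(\<Sum>y\<in>S. p h x y) = 1" using tf x that unfolding transition_function_def by auto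
    have "(\<Sum>y\<in>S. p h x y * f y) = (\<Sum>y\<in>S. p h x y) * f x + (\<Sum>y\<in>S. p h x y * (f y - f x))"
      by (simp add: sum_distrib_left sum_subtractf algebra_simps)
    also have "(\<Sum>y\<in>S. p h x y * (f y - f x)) = (\<Sum>y\<in>S - {x}. p h x y * (f y - f x))"
      using \<open>finite S\<close> x by (subst sum.remove) auto
    finally show ?thesis using one by (simp add: r_def)
  qed
  have deriv: "((\<lambda>h. p h x y) has_real_derivative q x y) (at 0 within {0..})" if "y \<in> S - {x}" for y
    using rates x that unfolding has_transition_rates_def by auto
  have "(r has_real_derivative
      exp (- \<alpha> * 0) * (\<Sum>y\<in>S - {x}. q x y * (f y - f x)) +
      exp (- \<alpha> * 0) * (- \<alpha>) * (f x + (\<Sum>y\<in>S - {x}. p 0 x y * (f y - f x)))) (at 0 within {0..})"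
    unfolding r_def
    by (rule derivative_eq_intros DERIV_sum deriv refl | simp)+
  then have "(r has_real_derivative 0) (at 0 within {0..})"
    using eigen p0 by simp
  moreover have "r 0 = 0" using p0 by (simp add: r_def)
  ultimately have "((\<lambda>h. r h / h) \<longlongrightarrow> 0) (at 0 within {0..})"
    by (simp add: has_field_derivative_iff)
  then have "eventually (\<lambda>h. \<bar>r h / h\<bar> < \<epsilon>) (at 0 within {0..})"
    using \<open>\<epsilon> > 0\<close> by (auto dest!: tendstoD simp: dist_real_def)
  moreover have "eventually (\<lambda>h::real. h \<in> {0..} \<and> h \<noteq> 0) (at 0 within {0..})"
    by (auto simp: eventually_at_filter)
  ultimately show ?thesis
  proof eventually_elim
    case (elim h)
    then have "\<bar>r h\<bar> \<le> \<epsilon> * h" by (simp add: abs_divide divide_less_eq)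
    with elim r_eq[of h] show ?case by simp
  qed
qed

context finite_markov_process
begin

text \<open>Finiteness of \<open>S\<close> gives one \<open>\<delta>\<close> for all states other
  than \<open>z\<close>, hence a bound uniform in the starting time \<open>s\<close> and the past
  event \<open>D\<close>. On \<open>D\<close> the state differs from \<open>z\<close>, so only
  states where the eigenvalue equation is assumed occur.\<close>

lemma one_step_error:
  assumes eigen: "\<And>x. x \<in> S \<Longrightarrow> x \<noteq> z \<Longrightarrow> (\<Sum>y\<in>S - {x}. q x y * (f y - f x)) = \<alpha> * f x"
    and "\<epsilon> > 0"
  obtains \<delta> where "\<delta> > 0"
    "\<And>h s D. 0 < h \<Longrightarrow> h < \<delta> \<Longrightarrow> 0 \<le> s \<Longrightarrow> D \<in> sets (natural_filtration M X s) \<Longrightarrow>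
       (\<And>\<omega>. \<omega> \<in> D \<Longrightarrow> X s \<omega> \<noteq> z) \<Longrightarrow>
       \<bar>\<integral>\<omega>. indicator D \<omega> * (exp (- \<alpha> * h) * f (X (s + h) \<omega>) - f (X s \<omega>)) \<partial>M\<bar> \<le> \<epsilon> * h"
proof -
  obtain p where p: "transition_function S p" "has_transition_rates S p q"
    and cond: "\<And>s t y. 0 \<le> s \<Longrightarrow> 0 \<le> t \<Longrightarrow> y \<in> S \<Longrightarrow> AE \<omega> in M.
           real_cond_exp M (natural_filtration M X s)
             (indicator {\<omega>'\<in>space M. X (s + t) \<omega>' = y}) \<omega> = p t (X s \<omega>) y"
    using markov unfolding markov_process_with_rates_def by blast
  have "eventually (\<lambda>h. \<forall>x\<in>S - {z}. \<bar>exp (- \<alpha> * h) * (\<Sum>y\<in>S. p h x y * f y) - f x\<bar> \<le> \<epsilon> * h)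
      (at 0 within {0..})"
    using finite_states \<open>\<epsilon> > 0\<close> eigen
    by (intro eventually_ball_finite ballI eigenfunction_semigroup_error[OF finite_states p]) auto
  then obtain \<delta> where \<delta>: "\<delta> > 0" "\<And>h x. 0 < h \<Longrightarrow> h < \<delta> \<Longrightarrow> x \<in> S - {z} \<Longrightarrow>
      \<bar>exp (- \<alpha> * h) * (\<Sum>y\<in>S. p h x y * f y) - f x\<bar> \<le> \<epsilon> * h"
    unfolding eventually_at by (force simp: dist_real_def)
  show thesis
  proof (rule that[OF \<delta>(1)])
    fix h s D
    assume h: "0 < h" "h < \<delta>" and s: "0 \<le> s" and D: "D \<in> sets (natural_filtration M X s)"
      and Dz: "\<And>\<omega>. \<omega> \<in> D \<Longrightarrow> X s \<omega> \<noteq> z"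
    have DM: "D \<in> sets M" using D by (rule sets_natural_filtration_imp)
    define r where "r x = exp (- \<alpha> * h) * (\<Sum>y\<in>S. p h x y * f y) - f x" for x
    note int = integrable_indicator_state[OF _ DM]
    have "(\<integral>\<omega>. indicator D \<omega> * (exp (- \<alpha> * h) * f (X (s + h) \<omega>) - f (X s \<omega>)) \<partial>M) =
        (\<integral>\<omega>. exp (- \<alpha> * h) * (indicator D \<omega> * f (X (s + h) \<omega>)) - indicator D \<omega> * f (X s \<omega>) \<partial>M)"
      by (simp add: algebra_simps)
    also have "\<dots> = exp (- \<alpha> * h) * (\<integral>\<omega>. indicator D \<omega> * f (X (s + h) \<omega>) \<partial>M)
        - (\<integral>\<omega>. indicator D \<omega> * f (X s \<omega>) \<partial>M)"
      using h s by (subst Bochner_Integration.integral_diff) (auto intro!: int)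
    also have "(\<integral>\<omega>. indicator D \<omega> * f (X (s + h) \<omega>) \<partial>M) =
        (\<integral>\<omega>. indicator D \<omega> * (\<Sum>y\<in>S. p h (X s \<omega>) y * f y) \<partial>M)"
      using h s by (intro integral_transition cond D) auto
    also have "exp (- \<alpha> * h) * \<dots> - (\<integral>\<omega>. indicator D \<omega> * f (X s \<omega>) \<partial>M) =
        (\<integral>\<omega>. exp (- \<alpha> * h) * (indicator D \<omega> * (\<Sum>y\<in>S. p h (X s \<omega>) y * f y))
           - indicator D \<omega> * f (X s \<omega>) \<partial>M)"
      using s int[of s "\<lambda>x. \<Sum>y\<in>S. p h x y * f y"]
      by (subst Bochner_Integration.integral_diff) (auto intro!: int)
    also have "\<dots> = (\<integral>\<omega>. indicator D \<omega> * r (X s \<omega>) \<partial>M)"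
      by (simp add: r_def algebra_simps)
    \<comment> \<open>The integrand is bounded pointwise by \<open>\<epsilon> * h\<close>, and
      \<open>M\<close> has total mass one.\<close>
    also have "\<bar>\<dots>\<bar> \<le> \<epsilon> * h"
    proof -
      have "\<bar>\<integral>\<omega>. indicator D \<omega> * r (X s \<omega>) \<partial>M\<bar> \<le> (\<integral>\<omega>. \<bar>indicator D \<omega> * r (X s \<omega>)\<bar> \<partial>M)"
        by (rule integral_abs_bound)
      also have "\<dots> \<le> (\<integral>\<omega>. \<epsilon> * h \<partial>M)"
      proof (rule integral_mono)
        fix \<omega> assume "\<omega> \<in> space M"
        then show "\<bar>indicator D \<omega> * r (X s \<omega>)\<bar> \<le> \<epsilon> * h"
          using \<delta>(2)[OF h, of "X s \<omega>"] state_mem[OF s] Dz h \<open>\<epsilon> > 0\<close>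
          by (cases "\<omega> \<in> D") (auto simp: r_def)
      qed (use int[OF s, of r] in auto)
      finally show ?thesis by (simp add: prob_space)
    qed
    finally show "\<bar>\<integral>\<omega>. indicator D \<omega> * (exp (- \<alpha> * h) * f (X (s + h) \<omega>) - f (X s \<omega>)) \<partial>M\<bar> \<le> \<epsilon> * h" .
  qed
qed

end

section \<open>Increments stopped on a grid and their pathwise limit\<close>

text \<open>The condition in the summand holds exactly for \<open>i < m\<close>, where
  \<open>m\<close> is the first index with \<open>P\<close>, or \<open>n\<close> if there is none
  below \<open>n\<close>; the surviving terms telescope.\<close>

lemma sum_increments_until_first:
  fixes y :: "nat \<Rightarrow> real"
  assumes "m \<le> n" "\<And>j. j < m \<Longrightarrow> \<not> P j" "P m \<or> m = n"
  shows "(\<Sum>i<n. if \<forall>j\<le>i. \<not> P j then y (Suc i) - y i else 0) = y m - y 0"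
proof -
  have "(\<Sum>i<n. if \<forall>j\<le>i. \<not> P j then y (Suc i) - y i else 0) = (\<Sum>i<m. y (Suc i) - y i)"
  proof (rule sum.mono_neutral_cong_right)
    show "\<forall>i\<in>{..<n} - {..<m}. (if \<forall>j\<le>i. \<not> P j then y (Suc i) - y i else 0) = 0"
      using assms by auto
  qed (use assms in auto)
  then show ?thesis by (simp add: sum_lessThan_telescope)
qed

context finite_markov_process
begin

text \<open>The increment from \<open>s\<close> of the exponentially weighted process, observed only at the points of
  the equidistant grid with \<open>n\<close> steps in \<open>[s, t]\<close> and stopped at the first of these at which the
  process is in \<open>z\<close>.\<close>

definition grid_increment ::
  "real \<Rightarrow> (nat \<Rightarrow> real) \<Rightarrow> nat \<Rightarrow> real \<Rightarrow> real \<Rightarrow> nat \<Rightarrow> 'a \<Rightarrow> real" where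
  "grid_increment \<alpha> f z s t n \<omega> = (\<Sum>i<n.
     if \<forall>j\<le>i. X (s + real j * ((t - s) / n)) \<omega> \<noteq> z
     then exp (- \<alpha> * (s + real (Suc i) * ((t - s) / n))) * f (X (s + real (Suc i) * ((t - s) / n)) \<omega>)
        - exp (- \<alpha> * (s + real i * ((t - s) / n))) * f (X (s + real i * ((t - s) / n)) \<omega>)
     else 0)"

lemma grid_increment_eq:
  assumes "m \<le> n" "\<And>j. j < m \<Longrightarrow> X (s + real j * ((t - s) / n)) \<omega> \<noteq> z"
    "X (s + real m * ((t - s) / n)) \<omega> = z \<or> m = n"
  shows "grid_increment \<alpha> f z s t n \<omega> =
    exp (- \<alpha> * (s + real m * ((t - s) / n))) * f (X (s + real m * ((t - s) / n)) \<omega>)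
      - exp (- \<alpha> * s) * f (X s \<omega>)"
  using sum_increments_until_first[of m n "\<lambda>j. X (s + real j * ((t - s) / n)) \<omega> = z"
      "\<lambda>j. exp (- \<alpha> * (s + real j * ((t - s) / n))) * f (X (s + real j * ((t - s) / n)) \<omega>)"] assms
  unfolding grid_increment_def by simp

text \<open>After telescoping only two values of the weighted process are left, each at most the sum
  of \<open>\<bar>f y\<bar>\<close> because the weight is at most 1. The bound does not depend on
  \<open>n\<close> and serves as dominating constant.\<close>

lemma abs_grid_increment_le:
  assumes "0 \<le> \<alpha>" "0 \<le> s" "s \<le> t" "\<omega> \<in> space M"
  shows "\<bar>grid_increment \<alpha> f z s t n \<omega>\<bar> \<le> 2 * (\<Sum>y\<in>S. \<bar>f y\<bar>)"
proof -
  let ?g = "\<lambda>j. s + real j * ((t - s) / n)"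
  obtain m where m: "m \<le> n" "\<And>j. j < m \<Longrightarrow> X (?g j) \<omega> \<noteq> z" "X (?g m) \<omega> = z \<or> m = n"
  proof -
    \<comment> \<open>The alternative \<open>m = n\<close> makes the minimum exist even if no grid
      point is in \<open>z\<close>.\<close>
    define m where "m = (LEAST m. X (?g m) \<omega> = z \<or> m = n)"
    have "X (?g m) \<omega> = z \<or> m = n" unfolding m_def by (rule LeastI[of _ n]) simp
    moreover have "m \<le> n" unfolding m_def by (rule Least_le) simp
    moreover have "X (?g j) \<omega> \<noteq> z" if "j < m" for j
      using not_less_Least[OF that[unfolded m_def]] by simp
    ultimately show thesis using that by blast
  qed
  have bound: "\<bar>exp (- \<alpha> * r) * f (X r \<omega>)\<bar> \<le> (\<Sum>y\<in>S. \<bar>f y\<bar>)" if "0 \<le> r" for r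
  proof -
    have "\<bar>exp (- \<alpha> * r) * f (X r \<omega>)\<bar> \<le> 1 * \<bar>f (X r \<omega>)\<bar>"
      unfolding abs_mult using assms that by (intro mult_right_mono) auto
    with abs_state_le[OF that assms(4), of f] show ?thesis by simp
  qed
  have "0 \<le> ?g m" using assms by simp
  from bound[OF this] bound[OF assms(2)] show ?thesis
    using grid_increment_eq[of m n s t \<omega> z \<alpha> f, OF m] by linarith
qed

text \<open>If \<open>z\<close> is not hit by \<open>t\<close>, no grid point sees it and the
  increment equals the limit for every \<open>n \<ge> 1\<close>. If it is hit at \<open>r\<close> in
  \<open>(s, t]\<close>, the first grid point from \<open>r\<close> on is within one mesh of
  \<open>r\<close>; for a fine mesh the path is still in \<open>z\<close> there, so the grid stops
  at that point.\<close>

lemma grid_increment_tendsto: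
  assumes st: "0 \<le> s" "s < t" and \<omega>: "\<omega> \<in> space M" and "\<not> hitting_time X z \<omega> \<le> ereal s"
  shows "(\<lambda>n. grid_increment \<alpha> f z s t n \<omega>) \<longlonglongrightarrow>
    stopped_process (\<lambda>t \<omega>. exp (- \<alpha> * t) * f (X t \<omega>)) (hitting_time X z) t \<omega>
      - exp (- \<alpha> * s) * f (X s \<omega>)"
proof -
  have t: "0 \<le> t" using st by simp
  show ?thesis
  proof (cases "hitting_time X z \<omega> \<le> ereal t")
    case False
    have "grid_increment \<alpha> f z s t n \<omega> = exp (- \<alpha> * t) * f (X t \<omega>) - exp (- \<alpha> * s) * f (X s \<omega>)"
      if "n \<ge> 1" for n
    proof -
      have last: "s + real n * ((t - s) / n) = t" using that by simp
      have "X (s + real j * ((t - s) / n)) \<omega> \<noteq> z" if "j < n" for j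
      proof -
        have "real j * ((t - s) / n) \<le> real n * ((t - s) / n)"
          using st that by (intro mult_right_mono) auto
        moreover have "0 \<le> real j * ((t - s) / n)" using st by simp
        ultimately have "0 \<le> s + real j * ((t - s) / n)" "s + real j * ((t - s) / n) \<le> t"
          using last st by linarith+
        with False st show ?thesis
          using hitting_time_le_iff[OF \<omega>, of t z] by auto
      qed
      then show ?thesis
        using grid_increment_eq[of n n s t \<omega> z \<alpha> f] last by simp
    qed
    then have "eventually (\<lambda>n. grid_increment \<alpha> f z s t n \<omega> =
        exp (- \<alpha> * t) * f (X t \<omega>) - exp (- \<alpha> * s) * f (X s \<omega>)) sequentially"
      by (intro eventually_sequentiallyI)
    then have "(\<lambda>n. grid_increment \<alpha> f z s t n \<omega>) \<longlonglongrightarrow>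
        exp (- \<alpha> * t) * f (X t \<omega>) - exp (- \<alpha> * s) * f (X s \<omega>)"
      by (rule tendsto_eventually)
    with False show ?thesis unfolding stopped_process_eq[OF \<omega> t] by simp
  next
    case True
    obtain r where r: "hitting_time X z \<omega> = ereal r"
      using True hitting_time_nonneg[of X z \<omega>] by (cases "hitting_time X z \<omega>") auto
    have rst: "s < r" "r \<le> t" using assms True r by auto
    note att = hitting_time_attained[OF \<omega> r]
    have before: "X u \<omega> \<noteq> z" if "0 \<le> u" "u < r" for u
      using hitting_time_le_iff[OF \<omega> that(1), of z] that r by auto
    obtain d where d: "d > 0" "\<And>u. r \<le> u \<Longrightarrow> u < r + d \<Longrightarrow> X u \<omega> = X r \<omega>"
      using locally_constant_right[OF \<omega> att(1)] by metis
    define \<delta> where "\<delta> n = (t - s) / real n" for n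
    \<comment> \<open>The index of the first grid point that is not before \<open>r\<close>. The
      conversion by \<open>nat\<close> loses nothing, as the quotient is positive for
      \<open>n \<ge> 1\<close>.\<close>
    define m where "m n = nat \<lceil>(r - s) / \<delta> n\<rceil>" for n
    define g where "g n = s + real (m n) * \<delta> n" for n
    have g: "r \<le> g n" "g n < r + \<delta> n" "m n \<le> n" "\<And>j. j < m n \<Longrightarrow> s + real j * \<delta> n < r"
      if n: "n \<ge> 1" for n
    proof -
      have dpos: "\<delta> n > 0" using st n by (simp add: \<delta>_def)
      have mr: "real (m n) = of_int \<lceil>(r - s) / \<delta> n\<rceil>"
        unfolding m_def using divide_pos_pos[of "r - s" "\<delta> n"] dpos rst
        by (subst of_nat_nat) linarith+
      have "(r - s) / \<delta> n \<le> real (m n)" "real (m n) < (r - s) / \<delta> n + 1"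
        unfolding mr by linarith+
      then show "r \<le> g n" "g n < r + \<delta> n"
        using dpos unfolding g_def by (auto simp: field_simps)
      have "(r - s) / \<delta> n \<le> real n"
        using dpos n rst st unfolding \<delta>_def by (simp add: field_simps)
      then have "\<lceil>(r - s) / \<delta> n\<rceil> \<le> int n" by (simp only: ceiling_le_iff of_int_of_nat_eq)
      then show "m n \<le> n" unfolding m_def nat_le_iff .
      fix j assume "j < m n"
      then have "real j < (r - s) / \<delta> n" unfolding m_def by linarith
      then show "s + real j * \<delta> n < r" using dpos by (simp add: field_simps)
    qed
    have \<delta>_lim: "\<delta> \<longlonglongrightarrow> 0"
      unfolding \<delta>_def by (rule lim_const_over_n)
    have "g \<longlonglongrightarrow> r"
    proof (rule tendsto_sandwich)
      show "eventually (\<lambda>n. r \<le> g n) sequentially" "eventually (\<lambda>n. g n \<le> r + \<delta> n) sequentially"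
        by (rule eventually_sequentiallyI[of 1], simp add: g(1) g(2)[THEN less_imp_le])+
      show "(\<lambda>n. r + \<delta> n) \<longlonglongrightarrow> r" using tendsto_add[OF tendsto_const \<delta>_lim, of r] by simp
    qed simp
    then have "(\<lambda>n. exp (- \<alpha> * g n) * f z - exp (- \<alpha> * s) * f (X s \<omega>)) \<longlonglongrightarrow>
        exp (- \<alpha> * r) * f z - exp (- \<alpha> * s) * f (X s \<omega>)"
      by (intro tendsto_intros)
    \<comment> \<open>Once the mesh is below \<open>d\<close>, the point \<open>g n\<close> lies in
      \<open>[r, r + d)\<close>, where the path stays in \<open>z\<close>, while all earlier grid
      points precede the hitting time.\<close>
    moreover have "eventually (\<lambda>n. \<delta> n < d) sequentially"
      using \<delta>_lim d(1) by (rule order_tendstoD)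
    then have "eventually (\<lambda>n. exp (- \<alpha> * g n) * f z - exp (- \<alpha> * s) * f (X s \<omega>) =
        grid_increment \<alpha> f z s t n \<omega>) sequentially"
      using eventually_ge_at_top[of 1]
    proof eventually_elim
      case (elim n)
      have hit: "X (g n) \<omega> = z"
        using d(2)[of "g n"] g(1,2)[OF elim(2)] elim(1) att(2) by simp
      have "X (s + real j * \<delta> n) \<omega> \<noteq> z" if "j < m n" for j
      proof (rule before)
        show "0 \<le> s + real j * \<delta> n" using st by (simp add: \<delta>_def)
      qed (rule g(4)[OF elim(2) that])
      then show ?case
        using grid_increment_eq[of "m n" n s t \<omega> z \<alpha> f] g(3)[OF elim(2)] hit
        by (simp add: \<delta>_def g_def)
    qed
    ultimately have "(\<lambda>n. grid_increment \<alpha> f z s t n \<omega>) \<longlonglongrightarrow>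
        exp (- \<alpha> * r) * f z - exp (- \<alpha> * s) * f (X s \<omega>)"
      by (rule Lim_transform_eventually)
    with True r show ?thesis unfolding stopped_process_eq[OF \<omega> t] by (simp add: min_absorb2)
  qed
qed

end

section \<open>Vanishing of the grid error and the martingale property\<close>

context finite_markov_process
begin

text \<open>The event \<open>B i\<close> says that the grid has not stopped by its point of index
  \<open>i\<close>. It is known at that grid time, so \<open>C \<inter> B i\<close> can play the
  past event in \<open>one_step_error\<close>; pulling the weight at that time out of each summand
  leaves precisely the integral estimated there.\<close>

lemma
  fixes z :: nat
  assumes "0 \<le> s" "s < t" "n \<ge> 1" and C: "C \<in> sets (natural_filtration M X s)"
  defines "\<delta> \<equiv> (t - s) / real n"
  defines "B \<equiv> \<lambda>i. {\<omega>\<in>space M. \<forall>j\<in>{..i}. X (s + real j * \<delta>) \<omega> \<noteq> z}"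
  shows sets_grid_no_hit: "C \<inter> B i \<in> sets (natural_filtration M X (s + real i * \<delta>))"
    and measurable_grid_increment: "(\<lambda>\<omega>. indicator C \<omega> * grid_increment \<alpha> f z s t n \<omega>) \<in> borel_measurable M"
    and integral_grid_increment_eq: "(\<integral>\<omega>. indicator C \<omega> * grid_increment \<alpha> f z s t n \<omega> \<partial>M) =
      (\<Sum>i<n. exp (- \<alpha> * (s + real i * \<delta>)) *
        (\<integral>\<omega>. indicator (C \<inter> B i) \<omega> *
          (exp (- \<alpha> * \<delta>) * f (X (s + real i * \<delta> + \<delta>) \<omega>) - f (X (s + real i * \<delta>) \<omega>)) \<partial>M))"
proof -
  have \<delta>: "0 < \<delta>" using assms by simp
  show sets: "C \<inter> B i \<in> sets (natural_filtration M X (s + real i * \<delta>))" for i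
  proof (rule sets.Int)
    show "C \<in> sets (natural_filtration M X (s + real i * \<delta>))"
      using C subalgebra_natural_filtration_mono[of s "s + real i * \<delta>" M X] \<delta>
      by (auto simp: subalgebra_def)
    have "{\<omega> \<in> space (natural_filtration M X (s + real i * \<delta>)). \<forall>j\<in>{..i}. X (s + real j * \<delta>) \<omega> \<noteq> z}
        \<in> sets (natural_filtration M X (s + real i * \<delta>))"
    proof (rule sets.sets_Collect_finite_All)
      fix j assume j: "j \<in> {..i}"
      have "X (s + real j * \<delta>) \<in> measurable (natural_filtration M X (s + real i * \<delta>)) (count_space UNIV)"
        using assms(1) \<delta> j by (intro measurable_natural_filtration) (auto intro!: mult_right_mono)
      from measurable_sets[OF this, of "- {z}"]
      show "{\<omega> \<in> space (natural_filtration M X (s + real i * \<delta>)). X (s + real j * \<delta>) \<omega> \<noteq> z}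
          \<in> sets (natural_filtration M X (s + real i * \<delta>))"
        by (simp add: vimage_def Int_def conj_commute)
    qed simp
    then show "B i \<in> sets (natural_filtration M X (s + real i * \<delta>))" by (simp add: B_def)
  qed
  define I where "I i \<omega> = indicator (C \<inter> B i) \<omega> *
      (exp (- \<alpha> * \<delta>) * f (X (s + real i * \<delta> + \<delta>) \<omega>) - f (X (s + real i * \<delta>) \<omega>))" for i \<omega>
  have int: "integrable M (I i)" for i
  proof -
    have "integrable M (\<lambda>\<omega>. exp (- \<alpha> * \<delta>) * f (X (s + real i * \<delta> + \<delta>) \<omega>) - f (X (s + real i * \<delta>) \<omega>))"
      using assms(1) \<delta> by (intro Bochner_Integration.integrable_diff integrable_mult_right integrable_state) auto
    from integrable_mult_indicator[OF sets_natural_filtration_imp[OF sets] this]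
    show ?thesis by (simp add: I_def[abs_def])
  qed
  have eq: "indicator C \<omega> * grid_increment \<alpha> f z s t n \<omega> =
      (\<Sum>i<n. exp (- \<alpha> * (s + real i * \<delta>)) * I i \<omega>)" if "\<omega> \<in> space M" for \<omega>
    unfolding grid_increment_def sum_distrib_left \<delta>_def[symmetric]
  proof (rule sum.cong[OF refl])
    fix i
    have 1: "s + real (Suc i) * \<delta> = s + real i * \<delta> + \<delta>" by (simp add: algebra_simps)
    have 2: "exp (- \<alpha> * (s + real i * \<delta> + \<delta>)) = exp (- \<alpha> * (s + real i * \<delta>)) * exp (- \<alpha> * \<delta>)"
      by (simp add: exp_add[symmetric] algebra_simps)
    show "indicator C \<omega> * (if \<forall>j\<le>i. X (s + real j * \<delta>) \<omega> \<noteq> z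
        then exp (- \<alpha> * (s + real (Suc i) * \<delta>)) * f (X (s + real (Suc i) * \<delta>) \<omega>) -
          exp (- \<alpha> * (s + real i * \<delta>)) * f (X (s + real i * \<delta>) \<omega>)
        else 0) = exp (- \<alpha> * (s + real i * \<delta>)) * I i \<omega>"
      unfolding 1 2 I_def B_def using that
      by (auto simp: indicator_def right_diff_distrib)
  qed
  show "(\<lambda>\<omega>. indicator C \<omega> * grid_increment \<alpha> f z s t n \<omega>) \<in> borel_measurable M"
    by (subst measurable_cong[OF eq]) (auto intro!: borel_measurable_sum borel_measurable_times borel_measurable_integrable int)
  have "(\<integral>\<omega>. indicator C \<omega> * grid_increment \<alpha> f z s t n \<omega> \<partial>M) =
      (\<integral>\<omega>. (\<Sum>i<n. exp (- \<alpha> * (s + real i * \<delta>)) * I i \<omega>) \<partial>M)"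
    by (intro Bochner_Integration.integral_cong eq) auto
  also have "\<dots> = (\<Sum>i<n. exp (- \<alpha> * (s + real i * \<delta>)) * (\<integral>\<omega>. I i \<omega> \<partial>M))"
    by (subst Bochner_Integration.integral_sum) (auto intro!: integrable_mult_right int)
  finally show "(\<integral>\<omega>. indicator C \<omega> * grid_increment \<alpha> f z s t n \<omega> \<partial>M) =
      (\<Sum>i<n. exp (- \<alpha> * (s + real i * \<delta>)) *
        (\<integral>\<omega>. indicator (C \<inter> B i) \<omega> *
          (exp (- \<alpha> * \<delta>) * f (X (s + real i * \<delta> + \<delta>) \<omega>) - f (X (s + real i * \<delta>) \<omega>)) \<partial>M))"
    unfolding I_def .
qed

text \<open>There are \<open>n\<close> steps of length \<open>(t - s) / n\<close>. Each contributes
  at most \<open>\<epsilon>\<close> times its length, since the weights are at most 1 for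
  \<open>0 \<le> \<alpha>\<close>, so the total is at most
  \<open>\<epsilon> * (t - s)\<close>.\<close>

lemma integral_grid_increment_tendsto_0:
  assumes eigen: "\<And>x. x \<in> S \<Longrightarrow> x \<noteq> z \<Longrightarrow> (\<Sum>y\<in>S - {x}. q x y * (f y - f x)) = \<alpha> * f x"
    and "0 \<le> \<alpha>" and st: "0 \<le> s" "s < t" and C: "C \<in> sets (natural_filtration M X s)"
  shows "(\<lambda>n. \<integral>\<omega>. indicator C \<omega> * grid_increment \<alpha> f z s t n \<omega> \<partial>M) \<longlonglongrightarrow> 0"
proof (rule LIMSEQ_I)
  fix e :: real assume "0 < e"
  \<comment> \<open>Chosen so that the total error is \<open>e / 2\<close>.\<close>
  define \<epsilon> where "\<epsilon> = e / (2 * (t - s))"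
  have \<epsilon>: "\<epsilon> > 0" using \<open>0 < e\<close> st by (simp add: \<epsilon>_def)
  obtain \<delta>0 where \<delta>0: "\<delta>0 > 0"
    and err: "\<And>h s D. 0 < h \<Longrightarrow> h < \<delta>0 \<Longrightarrow> 0 \<le> s \<Longrightarrow> D \<in> sets (natural_filtration M X s) \<Longrightarrow>
       (\<And>\<omega>. \<omega> \<in> D \<Longrightarrow> X s \<omega> \<noteq> z) \<Longrightarrow>
       \<bar>\<integral>\<omega>. indicator D \<omega> * (exp (- \<alpha> * h) * f (X (s + h) \<omega>) - f (X s \<omega>)) \<partial>M\<bar> \<le> \<epsilon> * h"
    using one_step_error[OF eigen \<epsilon>] by blast
  have "(\<lambda>n. (t - s) / real n) \<longlonglongrightarrow> 0" by (rule lim_const_over_n)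
  then have "eventually (\<lambda>n. (t - s) / real n < \<delta>0) sequentially"
    using \<delta>0 by (rule order_tendstoD)
  then have "eventually (\<lambda>n. norm ((\<integral>\<omega>. indicator C \<omega> * grid_increment \<alpha> f z s t n \<omega> \<partial>M) - 0) < e) sequentially"
    using eventually_ge_at_top[of 1]
  proof eventually_elim
    case (elim n)
    define \<delta> where "\<delta> = (t - s) / real n"
    define B where "B i = {\<omega>\<in>space M. \<forall>j\<in>{..i}. X (s + real j * \<delta>) \<omega> \<noteq> z}" for i
    have \<delta>: "0 < \<delta>" "\<delta> < \<delta>0" using elim st by (auto simp: \<delta>_def)
    have sets: "C \<inter> B i \<in> sets (natural_filtration M X (s + real i * \<delta>))" for i
      using sets_grid_no_hit[OF st elim(2) C, of i z] by (simp add: \<delta>_def B_def)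
    let ?J = "\<lambda>i. \<integral>\<omega>. indicator (C \<inter> B i) \<omega> *
          (exp (- \<alpha> * \<delta>) * f (X (s + real i * \<delta> + \<delta>) \<omega>) - f (X (s + real i * \<delta>) \<omega>)) \<partial>M"
    have "\<bar>\<integral>\<omega>. indicator C \<omega> * grid_increment \<alpha> f z s t n \<omega> \<partial>M\<bar> =
        \<bar>\<Sum>i<n. exp (- \<alpha> * (s + real i * \<delta>)) * ?J i\<bar>"
      using integral_grid_increment_eq[OF st elim(2) C, of \<alpha> f z] by (simp only: \<delta>_def B_def)
    also have "\<dots> \<le> (\<Sum>i<n. \<bar>exp (- \<alpha> * (s + real i * \<delta>)) * ?J i\<bar>)"
      by (rule sum_abs)
    also have "\<dots> \<le> (\<Sum>i<n. 1 * (\<epsilon> * \<delta>))"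
    proof (rule sum_mono)
      fix i
      have pos: "0 \<le> s + real i * \<delta>" using st \<delta> by simp
      have "\<bar>?J i\<bar> \<le> \<epsilon> * \<delta>"
        using \<delta> pos sets by (rule err) (auto simp: B_def)
      then show "\<bar>exp (- \<alpha> * (s + real i * \<delta>)) * ?J i\<bar> \<le> 1 * (\<epsilon> * \<delta>)"
        unfolding abs_mult using \<open>0 \<le> \<alpha>\<close> pos \<epsilon> \<delta> by (intro mult_mono) auto
    qed
    also have "\<dots> = \<epsilon> * (t - s)" using elim(2) by (simp add: \<delta>_def)
    also have "\<dots> = e / 2" using st by (simp add: \<epsilon>_def field_simps)
    also have "\<dots> < e" using \<open>0 < e\<close> by simp
    finally show ?case by simp
  qed
  then show "\<exists>n0. \<forall>n\<ge>n0. norm ((\<integral>\<omega>. indicator C \<omega> * grid_increment \<alpha> f z s t n \<omega> \<partial>M) - 0) < e"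
    by (simp add: eventually_sequentially)
qed

lemma abs_stopped_process_le:
  assumes "0 \<le> \<alpha>" "0 \<le> t" and \<omega>: "\<omega> \<in> space M"
  shows "\<bar>stopped_process (\<lambda>t \<omega>. exp (- \<alpha> * t) * f (X t \<omega>)) (hitting_time X z) t \<omega>\<bar> \<le> (\<Sum>y\<in>S. \<bar>f y\<bar>)"
proof -
  define r where "r = real_of_ereal (min (ereal t) (hitting_time X z \<omega>))"
  have r: "0 \<le> r" using assms(2) hitting_time_nonneg[of X z \<omega>] unfolding r_def
    by (intro real_of_ereal_pos) simp
  have "\<bar>exp (- \<alpha> * r) * f (X r \<omega>)\<bar> \<le> 1 * \<bar>f (X r \<omega>)\<bar>"
    unfolding abs_mult using assms(1) r by (intro mult_right_mono) auto
  with abs_state_le[OF r \<omega>, of f] show ?thesis by (simp add: stopped_process_def r_def)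
qed

lemma integrable_stopped_process:
  assumes "0 \<le> \<alpha>" "0 \<le> t"
  shows "integrable M (stopped_process (\<lambda>t \<omega>. exp (- \<alpha> * t) * f (X t \<omega>)) (hitting_time X z) t)"
  using assms abs_stopped_process_le[of \<alpha> t _ f z]
    measurable_from_subalg[OF subalgebra_natural_filtration measurable_stopped_process]
  by (intro integrable_const_bound[of _ "\<Sum>y\<in>S. \<bar>f y\<bar>"]) auto

text \<open>A conditional expectation is characterised by its integrals over past events
  \<open>A\<close>, so it suffices that the increment of the stopped process from \<open>s\<close>
  to \<open>t\<close> integrates to zero over each \<open>A\<close>. That integral is the limit of
  the integrals of grid increments, which tend to zero.\<close>

theorem martingale_stopped_eigenfunction:
  assumes eigen: "\<And>x. x \<in> S \<Longrightarrow> x \<noteq> z \<Longrightarrow> (\<Sum>y\<in>S - {x}. q x y * (f y - f x)) = \<alpha> * f x"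
    and "0 \<le> \<alpha>"
  shows "martingale M (natural_filtration M X)
           (stopped_process (\<lambda>t \<omega>. exp (- \<alpha> * t) * f (X t \<omega>)) (hitting_time X z))"
proof -
  define Z where "Z = stopped_process (\<lambda>t \<omega>. exp (- \<alpha> * t) * f (X t \<omega>)) (hitting_time X z)"
  have meas: "Z t \<in> borel_measurable (natural_filtration M X t)" and int: "integrable M (Z t)"
    if "0 \<le> t" for t
    using measurable_stopped_process integrable_stopped_process \<open>0 \<le> \<alpha>\<close> that unfolding Z_def by auto
  have cond: "AE \<omega> in M. real_cond_exp M (natural_filtration M X s) (Z t) \<omega> = Z s \<omega>"
    if st: "0 \<le> s" "s \<le> t" for s t
  proof -
    interpret F: sigma_finite_subalgebra M "natural_filtration M X s"
      by (rule sigma_finite_subalgebra_natural_filtration)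
    have t: "0 \<le> t" using st by simp
    show ?thesis
    proof (rule F.real_cond_exp_charact)
      fix A assume A: "A \<in> sets (natural_filtration M X s)"
      show "(\<integral>\<omega>\<in>A. Z t \<omega> \<partial>M) = (\<integral>\<omega>\<in>A. Z s \<omega> \<partial>M)"
      proof (cases "s = t")
        case False
        then have st': "s < t" using st by simp
        define C where "C = A \<inter> (space M - {\<omega>\<in>space M. hitting_time X z \<omega> \<le> ereal s})"
        have C: "C \<in> sets (natural_filtration M X s)"
          using sets.Int[OF A sets.compl_sets[OF sets_hitting_time_le[OF st(1), of z]]] by (simp add: C_def)
        have AM: "A \<in> sets M" and CM: "C \<in> sets M"
          using A C sets_natural_filtration_imp by auto
        \<comment> \<open>After a hit by time \<open>s\<close> the stopped process is frozen, so
          \<open>A - C\<close> contributes nothing; on \<open>C\<close> the value at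
          \<open>s\<close> is the unstopped one, from which the grid increment starts.\<close>
        have after: "indicator A \<omega> * (Z t \<omega> - Z s \<omega>) =
            indicator C \<omega> * (Z t \<omega> - exp (- \<alpha> * s) * f (X s \<omega>))" if \<omega>: "\<omega> \<in> space M" for \<omega>
        proof (cases "hitting_time X z \<omega> \<le> ereal s")
          case True
          then have "hitting_time X z \<omega> \<le> ereal t"
            using st by (meson ereal_less_eq(3) order_trans)
          with True have "Z t \<omega> = Z s \<omega>"
            unfolding Z_def stopped_process_eq[OF \<omega> t] stopped_process_eq[OF \<omega> st(1)]
            by (simp add: min_absorb2)
          with True show ?thesis by (simp add: C_def)
        next
          case False
          then have "Z s \<omega> = exp (- \<alpha> * s) * f (X s \<omega>)"
            unfolding Z_def stopped_process_eq[OF \<omega> st(1)] by simp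
          with False \<omega> show ?thesis by (simp add: C_def indicator_def)
        qed
        let ?L = "\<lambda>\<omega>. indicator C \<omega> * (Z t \<omega> - exp (- \<alpha> * s) * f (X s \<omega>))"
        \<comment> \<open>The shift to \<open>Suc n\<close> leaves out the grid with zero
          steps.\<close>
        have "(\<lambda>n. \<integral>\<omega>. indicator C \<omega> * grid_increment \<alpha> f z s t (Suc n) \<omega> \<partial>M) \<longlonglongrightarrow> (\<integral>\<omega>. ?L \<omega> \<partial>M)"
        proof (rule integral_dominated_convergence[where w = "\<lambda>_. 2 * (\<Sum>y\<in>S. \<bar>f y\<bar>)"])
          show "?L \<in> borel_measurable M"
            using CM int[OF t] integrable_state[OF st(1), of f] by measurable
          show "(\<lambda>\<omega>. indicator C \<omega> * grid_increment \<alpha> f z s t (Suc n) \<omega>) \<in> borel_measurable M" for n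
            by (rule measurable_grid_increment[OF st(1) st' _ C]) simp
          show "AE \<omega> in M. (\<lambda>n. indicator C \<omega> * grid_increment \<alpha> f z s t (Suc n) \<omega>) \<longlonglongrightarrow> ?L \<omega>"
          proof (rule AE_I2)
            fix \<omega> assume \<omega>: "\<omega> \<in> space M"
            show "(\<lambda>n. indicator C \<omega> * grid_increment \<alpha> f z s t (Suc n) \<omega>) \<longlonglongrightarrow> ?L \<omega>"
            proof (cases "\<omega> \<in> C")
              case True
              then have "\<not> hitting_time X z \<omega> \<le> ereal s" using \<omega> by (simp add: C_def)
              from LIMSEQ_Suc[OF grid_increment_tendsto[OF st(1) st' \<omega> this, of \<alpha> f]] True
              show ?thesis by (simp add: Z_def)
            qed simp
          qed
          show "AE \<omega> in M. norm (indicator C \<omega> * grid_increment \<alpha> f z s t (Suc n) \<omega>) \<le> 2 * (\<Sum>y\<in>S. \<bar>f y\<bar>)" for n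
          proof (rule AE_I2)
            fix \<omega> assume "\<omega> \<in> space M"
            from abs_grid_increment_le[OF \<open>0 \<le> \<alpha>\<close> st this, of f z "Suc n"]
            show "norm (indicator C \<omega> * grid_increment \<alpha> f z s t (Suc n) \<omega>) \<le> 2 * (\<Sum>y\<in>S. \<bar>f y\<bar>)"
              by (auto simp: indicator_def intro: order_trans[OF abs_ge_zero])
          qed
        qed simp
        moreover have "(\<lambda>n. \<integral>\<omega>. indicator C \<omega> * grid_increment \<alpha> f z s t (Suc n) \<omega> \<partial>M) \<longlonglongrightarrow> 0"
          by (rule LIMSEQ_Suc[OF integral_grid_increment_tendsto_0[OF eigen \<open>0 \<le> \<alpha>\<close> st(1) st' C]])
        ultimately have "(\<integral>\<omega>. ?L \<omega> \<partial>M) = 0" by (rule LIMSEQ_unique)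
        then have "(\<integral>\<omega>. indicator A \<omega> * (Z t \<omega> - Z s \<omega>) \<partial>M) = 0"
          using after by (simp cong: Bochner_Integration.integral_cong)
        moreover have "(\<integral>\<omega>. indicator A \<omega> * (Z t \<omega> - Z s \<omega>) \<partial>M) =
            (\<integral>\<omega>\<in>A. Z t \<omega> \<partial>M) - (\<integral>\<omega>\<in>A. Z s \<omega> \<partial>M)"
          using integrable_mult_indicator[OF AM int[OF t]] integrable_mult_indicator[OF AM int[OF st(1)]]
          unfolding set_lebesgue_integral_def
          by (subst Bochner_Integration.integral_diff[symmetric]) (auto simp: right_diff_distrib)
        ultimately show ?thesis by simp
      qed simp
    qed (use st t int meas in auto)
  qed
  show ?thesis
    unfolding martingale_def Z_def[symmetric]
    using subalgebra_natural_filtration subalgebra_natural_filtration_mono meas int cond by auto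
qed

end

section \<open>The integrals and their recurrence\<close>

text \<open>The common form of both integrals. In state \<open>x\<close>, the process
  \<open>I\<close> has \<open>a = x\<close>, \<open>b = N - x\<close>,
  \<open>c = \<nu> / \<mu>\<close>, and \<open>J\<close> has \<open>a = N - x\<close>,
  \<open>b = x\<close>, \<open>c = \<mu> / \<nu>\<close>; one recurrence in \<open>a\<close> and
  \<open>b\<close> serves both.\<close>

definition duality_integral :: "real \<Rightarrow> real \<Rightarrow> nat \<Rightarrow> nat \<Rightarrow> real" where
  "duality_integral \<alpha> c a b = (LBINT u:{0..1}. (1 - u) ^ a * (1 + c * u) ^ b * u powr (\<alpha> - 1))"

text \<open>The polynomial factor is bounded on the compact interval, and
  \<open>u powr (\<alpha> - 1)\<close>, possibly singular at 0, is integrable as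
  \<open>\<alpha> > 0\<close>. Passing to the gauge integral makes the fundamental theorem of
  calculus applicable.\<close>

lemma has_integral_duality_integral:
  assumes "\<alpha> > 0"
  shows "((\<lambda>u. (1 - u) ^ a * (1 + c * u) ^ b * u powr (\<alpha> - 1)) has_integral duality_integral \<alpha> c a b) {0..1}"
proof -
  have "(\<lambda>u::real. u powr (\<alpha> - 1)) absolutely_integrable_on {0..1}"
    using assms by (intro nonnegative_absolutely_integrable_1 integrable_on_powr_from_0) auto
  then have powr: "set_integrable lborel {0..1} (\<lambda>u::real. u powr (\<alpha> - 1))"
    unfolding set_integrable_def by (subst (asm) integrable_completion) auto
  have "continuous_on {0..1} (\<lambda>u::real. (1 - u) ^ a * (1 + c * u) ^ b)"
    by (intro continuous_intros)
  then have "compact ((\<lambda>u::real. (1 - u) ^ a * (1 + c * u) ^ b) ` {0..1})"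
    by (rule compact_continuous_image) simp
  then obtain K where K: "\<And>u::real. u \<in> {0..1} \<Longrightarrow> \<bar>(1 - u) ^ a * (1 + c * u) ^ b\<bar> \<le> K"
    by (fastforce dest!: compact_imp_bounded simp: bounded_iff)
  have "set_integrable lborel {0..1} (\<lambda>u::real. (1 - u) ^ a * (1 + c * u) ^ b * u powr (\<alpha> - 1))"
  proof (rule set_integrable_bound[OF set_integrable_mult_right[of K, OF powr]])
    show "set_borel_measurable lborel {0..1} (\<lambda>u::real. (1 - u) ^ a * (1 + c * u) ^ b * u powr (\<alpha> - 1))"
      unfolding set_borel_measurable_def by measurable
    show "AE u in lborel. u \<in> {0..1} \<longrightarrow>
        norm ((1 - u) ^ a * (1 + c * u) ^ b * u powr (\<alpha> - 1)) \<le> norm (K * u powr (\<alpha> - 1))"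
    proof (intro AE_I2 impI)
      fix u :: real assume "u \<in> {0..1}"
      from K[OF this] have "\<bar>(1 - u) ^ a * (1 + c * u) ^ b\<bar> \<le> \<bar>K\<bar>" by linarith
      then show "norm ((1 - u) ^ a * (1 + c * u) ^ b * u powr (\<alpha> - 1)) \<le> norm (K * u powr (\<alpha> - 1))"
        by (simp add: abs_mult[of _ "u powr (\<alpha> - 1)"] mult_right_mono)
    qed
  qed
  from set_borel_integral_eq_integral[OF this] show ?thesis
    unfolding duality_integral_def by (simp add: has_integral_integrable_integral)
qed

text \<open>The integrand of the combination is the derivative of
  \<open>- (1 + c) u\<^sup>\<alpha> (1 - u)\<^sup>a (1 + c u)\<^sup>b\<close>, which vanishes at both ends of the interval because \<open>a > 0\<close>.\<close>

lemma duality_integral_recurrence: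
  assumes "\<alpha> > 0" "a \<ge> 1"
  shows "real a * (duality_integral \<alpha> c (a - 1) (b + 1) - duality_integral \<alpha> c a b)
       + c * real b * (duality_integral \<alpha> c (a + 1) (b - 1) - duality_integral \<alpha> c a b)
     = (1 + c) * \<alpha> * duality_integral \<alpha> c a b"
proof -
  define P where "P a b u = (1 - u) ^ a * (1 + c * u) ^ b * u powr (\<alpha> - 1)" for a b and u :: real
  define h where "h u = real a * (P (a - 1) (b + 1) u - P a b u)
       + c * real b * (P (a + 1) (b - 1) u - P a b u) - (1 + c) * \<alpha> * P a b u" for u
  define F where "F u = - (1 + c) * (u powr \<alpha> * ((1 - u) ^ a * (1 + c * u) ^ b))" for u :: real
  have int: "(P a b has_integral duality_integral \<alpha> c a b) {0..1}" for a b
    using has_integral_duality_integral[OF assms(1)] unfolding P_def .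
  have "(h has_integral real a * (duality_integral \<alpha> c (a - 1) (b + 1) - duality_integral \<alpha> c a b)
       + c * real b * (duality_integral \<alpha> c (a + 1) (b - 1) - duality_integral \<alpha> c a b)
       - (1 + c) * \<alpha> * duality_integral \<alpha> c a b) {0..1}"
    unfolding h_def by (intro has_integral_add has_integral_diff has_integral_mult_right int)
  moreover have "(h has_integral 0) {0..1}"
  proof -
    have "(h has_integral F 1 - F 0) {0..1}"
    \<comment> \<open>Differentiability is asked for only inside the interval: for
      \<open>\<alpha> < 1\<close> it may fail at 0, where \<open>F\<close> is still
      continuous.\<close>
    proof (rule fundamental_theorem_of_calculus_interior)
      show "continuous_on {0..1} F"
        unfolding F_def using assms(1) by (intro continuous_intros continuous_on_powr') auto
      fix u :: real assume u: "u \<in> {0<..<1}"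
      have powr: "u powr \<alpha> = u * u powr (\<alpha> - 1)"
        using u by (simp add: powr_diff)
      obtain a' where a': "a = Suc a'" using assms(2) by (cases a) auto
      have "(F has_real_derivative - (1 + c) *
          (\<alpha> * u powr (\<alpha> - 1) * ((1 - u) ^ a * (1 + c * u) ^ b) +
           (- real a * (1 - u) ^ (a - 1) * (1 + c * u) ^ b + real b * (1 + c * u) ^ (b - 1) * c * (1 - u) ^ a)
             * u powr \<alpha>)) (at u)"
        unfolding F_def
        by (rule derivative_eq_intros refl | use u in simp)+
      \<comment> \<open>By (1 + c u) - (1 - u) = (1 + c) u, both differences in \<open>h\<close>
        carry the factor (1 + c) u. For \<open>b = 0\<close> the truncated \<open>b - 1\<close> only
        occurs multiplied by zero.\<close>
      also have "- (1 + c) *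
          (\<alpha> * u powr (\<alpha> - 1) * ((1 - u) ^ a * (1 + c * u) ^ b) +
           (- real a * (1 - u) ^ (a - 1) * (1 + c * u) ^ b + real b * (1 + c * u) ^ (b - 1) * c * (1 - u) ^ a)
             * u powr \<alpha>) = h u"
        unfolding h_def P_def powr a'
        by (cases b) (simp_all add: algebra_simps)
      finally show "(F has_vector_derivative h u) (at u)"
        by (simp add: has_real_derivative_iff_has_vector_derivative)
    qed simp
    moreover have "F 1 = 0" "F 0 = 0"
      using assms by (auto simp: F_def)
    ultimately show ?thesis by simp
  qed
  ultimately have "real a * (duality_integral \<alpha> c (a - 1) (b + 1) - duality_integral \<alpha> c a b)
       + c * real b * (duality_integral \<alpha> c (a + 1) (b - 1) - duality_integral \<alpha> c a b)
       - (1 + c) * \<alpha> * duality_integral \<alpha> c a b = 0"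
    by (rule has_integral_unique)
  then show ?thesis by simp
qed

section \<open>The Ehrenfest process\<close>

text \<open>Only the two neighbours of \<open>x\<close> have nonzero rates. At the ends, the terms
  with \<open>N + 1\<close> and with the truncated \<open>0 - 1\<close> lie outside the sum, and on
  the right their coefficients are zero.\<close>

lemma ehrenfest_generator:
  assumes "x \<le> N"
  shows "(\<Sum>y\<in>{0..N} - {x}. ehrenfest_rate N \<nu> \<mu> x y * (f y - f x)) =
    \<nu> * real (N - x) * (f (x + 1) - f x) + \<mu> * real x * (f (x - 1) - f x)"
proof -
  have "(\<Sum>y\<in>{0..N} - {x}. ehrenfest_rate N \<nu> \<mu> x y * (f y - f x)) =
      (\<Sum>y\<in>{0..N} - {x}. (if y = x + 1 then \<nu> * (real N - real x) * (f y - f x) else 0) +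
        (if y = x - 1 then \<mu> * real x * (f y - f x) else 0))"
    by (intro sum.cong) (auto simp: ehrenfest_rate_def)
  also have "\<dots> = \<nu> * real (N - x) * (f (x + 1) - f x) + \<mu> * real x * (f (x - 1) - f x)"
    using assms by (auto simp: sum.distrib sum.delta of_nat_diff)
  finally show ?thesis .
qed

theorem proposition2:
  fixes M :: "'a measure"
    and E :: "real \<Rightarrow> 'a \<Rightarrow> nat"
    and N :: nat
    and \<mu> \<nu> \<alpha> :: real
  assumes "\<mu> > 0" and "\<nu> > 0" and "\<mu> + \<nu> = 1"
    and "N \<ge> 1"
    and "ehrenfest_process M N \<nu> \<mu> E"
    and "\<alpha> > 0"
  shows "martingale M (natural_filtration M E)
           (stopped_process (I_process N \<nu> \<mu> E \<alpha>) (hitting_time E 0))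
       \<and> martingale M (natural_filtration M E)
           (stopped_process (J_process N \<nu> \<mu> E \<alpha>) (hitting_time E N))"
proof -
  have markov: "markov_process_with_rates M {0..N} (ehrenfest_rate N \<nu> \<mu>) E"
    using assms(5) unfolding ehrenfest_process_def .
  interpret prob_space M
    using markov unfolding markov_process_with_rates_def by blast
  interpret finite_markov_process M "{0..N}" "ehrenfest_rate N \<nu> \<mu>" E
    by unfold_locales (rule markov)
  let ?f = "\<lambda>x. duality_integral \<alpha> (\<nu> / \<mu>) x (N - x)"
  let ?g = "\<lambda>x. duality_integral \<alpha> (\<mu> / \<nu>) (N - x) x"
  have I: "I_process N \<nu> \<mu> E \<alpha> = (\<lambda>t \<omega>. exp (- \<alpha> * t) * ?f (E t \<omega>))"
    by (intro ext) (simp add: I_process_def duality_integral_def)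
  have J: "J_process N \<nu> \<mu> E \<alpha> = (\<lambda>t \<omega>. exp (- \<alpha> * t) * ?g (E t \<omega>))"
    by (intro ext) (simp add: J_process_def duality_integral_def)
  have "(\<Sum>y\<in>{0..N} - {x}. ehrenfest_rate N \<nu> \<mu> x y * (?f y - ?f x)) = \<alpha> * ?f x"
    if x: "x \<in> {0..N}" "x \<noteq> 0" for x
  proof -
    \<comment> \<open>Factoring out \<mu> brings the generator into the shape of the recurrence with
      \<open>a = x\<close>; its condition \<open>a \<ge> 1\<close> is \<open>x \<noteq> 0\<close>.
      The eigenvalue is then \<mu> (1 + \<nu>/\<mu>) \<alpha> = \<alpha>.\<close>
    have "(\<Sum>y\<in>{0..N} - {x}. ehrenfest_rate N \<nu> \<mu> x y * (?f y - ?f x)) =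
        \<mu> * (real x * (?f (x - 1) - ?f x) + \<nu> / \<mu> * real (N - x) * (?f (x + 1) - ?f x))"
      using x \<open>\<mu> > 0\<close> ehrenfest_generator[of x N \<nu> \<mu> ?f] by (simp add: distrib_left)
    also have "\<dots> = \<mu> * ((1 + \<nu> / \<mu>) * \<alpha> * ?f x)"
      using duality_integral_recurrence[OF \<open>\<alpha> > 0\<close>, of x "\<nu> / \<mu>" "N - x"] x by (simp add: Suc_diff_le)
    also have "\<dots> = (\<mu> + \<nu>) * \<alpha> * ?f x" using \<open>\<mu> > 0\<close> by (simp add: field_simps)
    finally show ?thesis using assms(3) by simp
  qed
  moreover have "(\<Sum>y\<in>{0..N} - {x}. ehrenfest_rate N \<nu> \<mu> x y * (?g y - ?g x)) = \<alpha> * ?g x"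
    if x: "x \<in> {0..N}" "x \<noteq> N" for x
  proof -
    \<comment> \<open>Here \<nu> is factored out and \<open>a = N - x\<close>, so the condition
      \<open>a \<ge> 1\<close> becomes \<open>x \<noteq> N\<close>.\<close>
    have "(\<Sum>y\<in>{0..N} - {x}. ehrenfest_rate N \<nu> \<mu> x y * (?g y - ?g x)) =
        \<nu> * (real (N - x) * (?g (x + 1) - ?g x) + \<mu> / \<nu> * real x * (?g (x - 1) - ?g x))"
      using x \<open>\<nu> > 0\<close> ehrenfest_generator[of x N \<nu> \<mu> ?g] by (simp add: distrib_left)
    \<comment> \<open>The index \<open>N - x + 1\<close> of the recurrence agrees with
      \<open>N - (x - 1)\<close> only for \<open>x > 0\<close>; for \<open>x = 0\<close> the term
      has coefficient zero.\<close>
    also have "\<dots> = \<nu> * ((1 + \<mu> / \<nu>) * \<alpha> * ?g x)"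
      using duality_integral_recurrence[OF \<open>\<alpha> > 0\<close>, of "N - x" "\<mu> / \<nu>" x] x
      by (cases x) (simp_all add: Suc_diff_Suc)
    also have "\<dots> = (\<mu> + \<nu>) * \<alpha> * ?g x" using \<open>\<nu> > 0\<close> by (simp add: field_simps)
    finally show ?thesis using assms(3) by simp
  qed
  ultimately show ?thesis
    unfolding I J using \<open>\<alpha> > 0\<close> by (intro conjI martingale_stopped_eigenfunction) auto
qed

end
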